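(* Let $L$ be a completely distributive lattice, $G$ a group, and $\mu$ an $L$-subgroup of $G$. Let $\eta$ be a maximal $L$-subgroup of $\mu$. Then $\eta$ is either a normal $L$-subgroup of $\mu$ or a contranormal $L$-subgroup of $\mu$.
   Context: $L$ is a completely distributive (in particular complete) lattice with greatest element $1$ and least element $0$; $G$ is a group. An $L$-subset of $G$ is a function $G\to L$; $\eta\subseteq\nu$ means $\eta(x)\le\nu(x)$ for all $x\in G$. An $L$-subgroup of $G$ is an $L$-subset $\mu$ with $\mu(xy)\ge\mu(x)\wedge\mu(y)$ and $\mu(x^{-1})=\mu(x)$ for all $x,y\in G$. An $L$-subgroup of $\mu$ is an $L$-subgroup $\eta$ of $G$ with $\eta\subseteq\mu$. It is proper if $\eta$ is non-constant and $\eta\ne\mu$. It is a normal $L$-subgroup of $\mu$ if $\eta(yxy^{-1})\ge\eta(x)\wedge\mu(y)$ for all $x,y\in G$. A proper $L$-subgroup $\eta$ of $\mu$ is a maximal $L$-subgroup of $\mu$ if whenever $\eta\subseteq\theta\subseteq\mu$ for some $L$-subgroup $\theta$ of $\mu$, then $\theta=\eta$ or $\theta=\mu$. For $a\in L$, $z\in G$, the $L$-point $a_z$ is the $L$-subset with value $a$ at $z$ and $0$ elsewhere; $a_z\in\mu$ means $\mu(z)\ge a$. For $\eta$ an $L$-subgroup of $\mu$ and $a_z\in\mu$, the conjugate $\eta^{a_z}$ is the $L$-subset $\eta^{a_z}(x)=a\wedge\eta(zxz^{-1})$, $x\in G$. An $L$-subgroup $\eta$ of $\mu$ is a contranormal $L$-subgroup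 of $\mu$ if there is no $L$-subgroup $\theta$ of $\mu$ with $\theta\neq\mu$ such that $\eta^{a_z}\subseteq\theta$ for every $L$-point $a_z\in\mu$. *)

theory Defs
  imports "HOL-Algebra.Group" "HOL-Library.FuncSet"
begin

text \<open>
  The lattice \<open>L\<close> is a type of class \<open>complete_distrib_lattice\<close>, whose axiom is complete
  distributivity for arbitrary families (not merely the frame law). An \<open>L\<close>-subset is extensional
  on the carrier of the group, so that HOL equality of \<open>L\<close>-subsets is equality of functions
  \<open>G \<rightarrow> L\<close>.
\<close>

definition L_subset :: "('g, 'm) monoid_scheme \<Rightarrow> ('g \<Rightarrow> 'l::complete_distrib_lattice) \<Rightarrow> bool"
  where "L_subset G \<mu> \<longleftrightarrow> \<mu> \<in> carrier G \<rightarrow>\<^sub>E UNIV"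

definition L_contained ::
    "('g, 'm) monoid_scheme \<Rightarrow> ('g \<Rightarrow> 'l::complete_distrib_lattice) \<Rightarrow> ('g \<Rightarrow> 'l) \<Rightarrow> bool"
  where "L_contained G \<eta> \<nu> \<longleftrightarrow> (\<forall>x\<in>carrier G. \<eta> x \<le> \<nu> x)"

definition L_subgroup :: "('g, 'm) monoid_scheme \<Rightarrow> ('g \<Rightarrow> 'l::complete_distrib_lattice) \<Rightarrow> bool"
  where "L_subgroup G \<mu> \<longleftrightarrow> L_subset G \<mu> \<and>
    (\<forall>x\<in>carrier G. \<forall>y\<in>carrier G. inf (\<mu> x) (\<mu> y) \<le> \<mu> (x \<otimes>\<^bsub>G\<^esub> y)) \<and>
    (\<forall>x\<in>carrier G. \<mu> (inv\<^bsub>G\<^esub> x) = \<mu> x)"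

definition L_subgroup_of ::
    "('g, 'm) monoid_scheme \<Rightarrow> ('g \<Rightarrow> 'l::complete_distrib_lattice) \<Rightarrow> ('g \<Rightarrow> 'l) \<Rightarrow> bool"
  where "L_subgroup_of G \<mu> \<eta> \<longleftrightarrow> L_subgroup G \<eta> \<and> L_contained G \<eta> \<mu>"

definition proper_L_subgroup_of ::
    "('g, 'm) monoid_scheme \<Rightarrow> ('g \<Rightarrow> 'l::complete_distrib_lattice) \<Rightarrow> ('g \<Rightarrow> 'l) \<Rightarrow> bool"
  where "proper_L_subgroup_of G \<mu> \<eta> \<longleftrightarrow> L_subgroup_of G \<mu> \<eta> \<and>
    \<not> (\<exists>c. \<forall>x\<in>carrier G. \<eta> x = c) \<and> \<eta> \<noteq> \<mu>"

definition normal_L_subgroup_of ::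
    "('g, 'm) monoid_scheme \<Rightarrow> ('g \<Rightarrow> 'l::complete_distrib_lattice) \<Rightarrow> ('g \<Rightarrow> 'l) \<Rightarrow> bool"
  where "normal_L_subgroup_of G \<mu> \<eta> \<longleftrightarrow> L_subgroup_of G \<mu> \<eta> \<and>
    (\<forall>x\<in>carrier G. \<forall>y\<in>carrier G. inf (\<eta> x) (\<mu> y) \<le> \<eta> (y \<otimes>\<^bsub>G\<^esub> x \<otimes>\<^bsub>G\<^esub> inv\<^bsub>G\<^esub> y))"

definition maximal_L_subgroup_of ::
    "('g, 'm) monoid_scheme \<Rightarrow> ('g \<Rightarrow> 'l::complete_distrib_lattice) \<Rightarrow> ('g \<Rightarrow> 'l) \<Rightarrow> bool"
  where "maximal_L_subgroup_of G \<mu> \<eta> \<longleftrightarrow> proper_L_subgroup_of G \<mu> \<eta> \<and>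
    (\<forall>\<theta>. L_subgroup_of G \<mu> \<theta> \<and> L_contained G \<eta> \<theta> \<and> L_contained G \<theta> \<mu> \<longrightarrow>
      \<theta> = \<eta> \<or> \<theta> = \<mu>)"

text \<open>
  An \<open>L\<close>-point \<open>a\<^sub>z\<close> is represented by the pair of its value \<open>a\<close> and its support \<open>z\<close>. As functions,
  all \<open>\<bottom>\<^sub>z\<close> coincide, but so do the conjugates by them.
\<close>

definition L_point_in ::
    "('g, 'm) monoid_scheme \<Rightarrow> 'l::complete_distrib_lattice \<Rightarrow> 'g \<Rightarrow> ('g \<Rightarrow> 'l) \<Rightarrow> bool"
  where "L_point_in G a z \<mu> \<longleftrightarrow> z \<in> carrier G \<and> a \<le> \<mu> z"

definition L_conjugate ::
    "('g, 'm) monoid_scheme \<Rightarrow> ('g \<Rightarrow> 'l::complete_distrib_lattice) \<Rightarrow> 'l \<Rightarrow> 'g \<Rightarrow> ('g \<Rightarrow> 'l)"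
  where "L_conjugate G \<eta> a z = (\<lambda>x\<in>carrier G. inf a (\<eta> (z \<otimes>\<^bsub>G\<^esub> x \<otimes>\<^bsub>G\<^esub> inv\<^bsub>G\<^esub> z)))"

definition contranormal_L_subgroup_of ::
    "('g, 'm) monoid_scheme \<Rightarrow> ('g \<Rightarrow> 'l::complete_distrib_lattice) \<Rightarrow> ('g \<Rightarrow> 'l) \<Rightarrow> bool"
  where "contranormal_L_subgroup_of G \<mu> \<eta> \<longleftrightarrow> L_subgroup_of G \<mu> \<eta> \<and>
    \<not> (\<exists>\<theta>. L_subgroup_of G \<mu> \<theta> \<and> \<theta> \<noteq> \<mu> \<and>
          (\<forall>a z. L_point_in G a z \<mu> \<longrightarrow> L_contained G (L_conjugate G \<eta> a z) \<theta>))"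

end

theory Submission
  imports Defs
begin

text \<open>
  Let \<open>\<theta> \<noteq> \<mu>\<close> contain every conjugate of \<open>\<eta>\<close>. The conjugate of \<open>\<eta>\<close> by the \<open>L\<close>-point of
  value \<open>\<mu>(1)\<close> at the identity is \<open>\<eta>\<close> itself, so \<open>\<eta> \<subseteq> \<theta>\<close>, and maximality gives \<open>\<theta> = \<eta>\<close>.
  Hence \<open>\<eta>\<close> contains all of its conjugates, which is normality.
\<close>

text \<open>The identity is the product of \<open>x\<close> and its inverse, and \<mu> takes the
  same value at both factors.\<close>

lemma L_subgroup_le_one:
  assumes "group G" "L_subgroup G \<mu>" "x \<in> carrier G"
  shows "\<mu> x \<le> \<mu> \<one>\<^bsub>G\<^esub>"
proof -
  interpret group G by fact
  have "inf (\<mu> x) (\<mu> (inv\<^bsub>G\<^esub> x)) \<le> \<mu> (x \<otimes>\<^bsub>G\<^esub> inv\<^bsub>G\<^esub> x)"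
    using assms(2,3) inv_closed[of x] unfolding L_subgroup_def by blast
  moreover have "\<mu> (inv\<^bsub>G\<^esub> x) = \<mu> x"
    using assms by (simp add: L_subgroup_def)
  ultimately show ?thesis
    using assms(3) by simp
qed

text \<open>Conjugation by the identity moves nothing, and the meet with the value of \<mu> there
  has no effect: that value is the largest one of \<mu>, so it bounds \<eta> from above.\<close>

lemma L_conjugate_one:
  assumes "group G" "L_subgroup G \<mu>" "L_subgroup_of G \<mu> \<eta>"
  shows "L_conjugate G \<eta> (\<mu> \<one>\<^bsub>G\<^esub>) \<one>\<^bsub>G\<^esub> = \<eta>"
proof
  interpret group G by fact
  fix x
  show "L_conjugate G \<eta> (\<mu> \<one>\<^bsub>G\<^esub>) \<one>\<^bsub>G\<^esub> x = \<eta> x"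
  proof (cases "x \<in> carrier G")
    case True
    then have "\<eta> x \<le> \<mu> \<one>\<^bsub>G\<^esub>"
      using assms L_subgroup_le_one[of G \<mu> x]
      by (auto simp: L_subgroup_of_def L_contained_def intro: order_trans)
    then show ?thesis
      using True by (simp add: L_conjugate_def inf_absorb2)
  next
    \<comment> \<open>Off the carrier both sides are \<open>undefined\<close>, since \<eta> is
      extensional and the conjugate is a restriction.\<close>
    case False
    moreover have "\<eta> \<in> carrier G \<rightarrow>\<^sub>E UNIV"
      using assms(3) by (simp add: L_subgroup_of_def L_subgroup_def L_subset_def)
    ultimately show ?thesis
      by (metis L_conjugate_def PiE_arb restrict_apply)
  qed
qed

text \<open>The conjugate by the point of value \<open>\<mu> y\<close> at the inverse of
  \<open>y\<close>, evaluated at \<open>?w\<close>, is exactly the meet of \<open>\<mu> y\<close>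
  and \<open>\<eta> x\<close>.\<close>

lemma normal_L_subgroup_ofI:
  assumes "group G" "L_subgroup G \<mu>" "L_subgroup_of G \<mu> \<eta>"
    and conj: "\<And>a z. L_point_in G a z \<mu> \<Longrightarrow> L_contained G (L_conjugate G \<eta> a z) \<eta>"
  shows "normal_L_subgroup_of G \<mu> \<eta>"
  unfolding normal_L_subgroup_of_def
proof (intro conjI ballI)
  interpret group G by fact
  fix x y
  assume xy: "x \<in> carrier G" "y \<in> carrier G"
  let ?w = "y \<otimes>\<^bsub>G\<^esub> x \<otimes>\<^bsub>G\<^esub> inv\<^bsub>G\<^esub> y"
  have "inv\<^bsub>G\<^esub> y \<otimes>\<^bsub>G\<^esub> (y \<otimes>\<^bsub>G\<^esub> x) = x"
    using xy by (simp flip: m_assoc)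
  then have "inv\<^bsub>G\<^esub> y \<otimes>\<^bsub>G\<^esub> ?w \<otimes>\<^bsub>G\<^esub> inv\<^bsub>G\<^esub> (inv\<^bsub>G\<^esub> y) = x"
    using xy by (simp add: m_assoc)
  \<comment> \<open>The support is the inverse of \<open>y\<close> because a conjugate with support
    \<open>z\<close> evaluates \<eta> at \<open>z\<close> times the argument times the inverse of
    \<open>z\<close>, which must undo the conjugation in \<open>?w\<close>.\<close>
  moreover have "L_point_in G (\<mu> y) (inv\<^bsub>G\<^esub> y) \<mu>"
    using xy assms(2) by (simp add: L_point_in_def L_subgroup_def)
  then have "L_contained G (L_conjugate G \<eta> (\<mu> y) (inv\<^bsub>G\<^esub> y)) \<eta>"
    by (rule conj)
  then have "L_conjugate G \<eta> (\<mu> y) (inv\<^bsub>G\<^esub> y) ?w \<le> \<eta> ?w"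
    using xy unfolding L_contained_def by (metis m_closed inv_closed)
  moreover have "?w \<in> carrier G"
    using xy by (intro m_closed inv_closed)
  ultimately show "inf (\<eta> x) (\<mu> y) \<le> \<eta> ?w"
    unfolding L_conjugate_def by (metis restrict_apply' inf_commute)
qed (fact assms(3))

theorem theorem4p9:
  fixes G :: "('g, 'm) monoid_scheme"
    and \<mu> \<eta> :: "'g \<Rightarrow> 'l::complete_distrib_lattice"
  assumes "group G"
    and "L_subgroup G \<mu>"
    and "maximal_L_subgroup_of G \<mu> \<eta>"
  shows "normal_L_subgroup_of G \<mu> \<eta> \<or> contranormal_L_subgroup_of G \<mu> \<eta>"
proof (rule disjCI)
  have sub: "L_subgroup_of G \<mu> \<eta>"
    using assms(3) by (simp add: maximal_L_subgroup_of_def proper_L_subgroup_of_def)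
  assume "\<not> contranormal_L_subgroup_of G \<mu> \<eta>"
  \<comment> \<open>By \<open>sub\<close>, contranormality can fail only through its second clause,
    which yields the witness \<theta>.\<close>
  then obtain \<theta> where \<theta>: "L_subgroup_of G \<mu> \<theta>" "\<theta> \<noteq> \<mu>"
    and conj: "\<And>a z. L_point_in G a z \<mu> \<Longrightarrow> L_contained G (L_conjugate G \<eta> a z) \<theta>"
    using sub by (auto simp: contranormal_L_subgroup_of_def)
  have "L_point_in G (\<mu> \<one>\<^bsub>G\<^esub>) \<one>\<^bsub>G\<^esub> \<mu>"
    using group.is_monoid[OF assms(1)] by (simp add: L_point_in_def monoid.one_closed)
  then have "L_contained G \<eta> \<theta>"
    using conj L_conjugate_one[OF assms(1,2) sub] by metis
  then have "\<theta> = \<eta>"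
    using assms(3) \<theta> by (auto simp: maximal_L_subgroup_of_def L_subgroup_of_def)
  then show "normal_L_subgroup_of G \<mu> \<eta>"
    using normal_L_subgroup_ofI[OF assms(1,2) sub] conj by simp
qed

end
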